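(* Let $k \geq 4$ be an even integer and let $u,g,\lambda$ be positive integers. If $(K_u \times K_g)(\lambda)$ has a $k$-ARCS, then (i) $u \geq 3$ and $g \geq 2$; (ii) $g(u-1) \equiv 0 \pmod{k}$; (iii) $\lambda(g-1) \equiv 0 \pmod{2}$.
   Context: For graphs $G,H$, the tensor product $G \times H$ has vertex set $V(G)\times V(H)$, with $(g_1,h_1)$ adjacent to $(g_2,h_2)$ iff $g_1g_2 \in E(G)$ and $h_1h_2 \in E(H)$. For a graph $G$ and positive integer $\lambda$, $G(\lambda)$ is the multigraph obtained by replacing each edge of $G$ by $\lambda$ parallel edges. $K_n$ is the complete graph on $n$ vertices. The graph $(K_u \times K_g)(\lambda)$ is regarded as a $u$-partite multigraph with partite sets $V_i = \{i\} \times V(K_g)$, $i=1,\dots,u$ (each of size $g$). A partial $C_k$-factor of $(K_u \times K_g)(\lambda)$ is a subgraph which, for some $i$, is a spanning subgraph of $(K_u \times K_g)(\lambda)\setminus V_i$ all of whose components are cycles of length $k$. A $k$-ARCS (almost resolvable $k$-cycle system) of $(K_u \times K_g)(\lambda)$ is a partition of its edge multiset into partial $C_k$-factors.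
   Formalization: A k-ARCS is required to contain at least one partial C_k-factor, and each factor at least one vertex; otherwise the edgeless cases u = 1 or g = 1 would have an empty (or null) system and (i) would fail. For u, g ≥ 2 nothing changes. *)

theory Defs
  imports "HOL-Library.Multiset" "HOL-Number_Theory.Cong"
begin

text \<open>An edge joining \<open>x\<close> and \<open>y\<close> is the set \<open>{x, y}\<close>.\<close>

record 'a graph =
  gverts :: "'a set"
  gedges :: "'a set set"

record 'a multigraph =
  mverts :: "'a set"
  medges :: "'a set multiset"

definition complete_graph :: "nat \<Rightarrow> nat graph" where
  "complete_graph n =
    \<lparr> gverts = {1..n}, gedges = {{x, y} | x y. x \<in> {1..n} \<and> y \<in> {1..n} \<and> x \<noteq> y} \<rparr>"

definition tensor_product :: "'a graph \<Rightarrow> 'b graph \<Rightarrow> ('a \<times> 'b) graph" where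
  "tensor_product G H =
    \<lparr> gverts = gverts G \<times> gverts H,
      gedges = {{(g1, h1), (g2, h2)} | g1 h1 g2 h2. {g1, g2} \<in> gedges G \<and> {h1, h2} \<in> gedges H} \<rparr>"

text \<open>The multigraph \<open>G(\<lambda>)\<close>. Only meaningful for finite \<open>G\<close>, because \<^const>\<open>mset_set\<close> of an
  infinite set is empty.\<close>

definition edge_multiple :: "'a graph \<Rightarrow> nat \<Rightarrow> 'a multigraph" where
  "edge_multiple G l = \<lparr> mverts = gverts G, medges = repeat_mset l (mset_set (gedges G)) \<rparr>"

definition submultigraph :: "'a multigraph \<Rightarrow> 'a multigraph \<Rightarrow> bool" where
  "submultigraph H G \<longleftrightarrow>
    mverts H \<subseteq> mverts G \<and> medges H \<subseteq># medges G \<and> (\<forall>e \<in># medges H. e \<subseteq> mverts H)"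

definition spanning_submultigraph :: "'a multigraph \<Rightarrow> 'a multigraph \<Rightarrow> bool" where
  "spanning_submultigraph H G \<longleftrightarrow> submultigraph H G \<and> mverts H = mverts G"

definition induced_submultigraph :: "'a multigraph \<Rightarrow> 'a set \<Rightarrow> 'a multigraph" where
  "induced_submultigraph G W = \<lparr> mverts = W, medges = {# e \<in># medges G. e \<subseteq> W #} \<rparr>"

definition delete_vertices :: "'a multigraph \<Rightarrow> 'a set \<Rightarrow> 'a multigraph" where
  "delete_vertices G W =
    \<lparr> mverts = mverts G - W, medges = {# e \<in># medges G. e \<inter> W = {} #} \<rparr>"

definition connected_rel :: "'a multigraph \<Rightarrow> ('a \<times> 'a) set" where
  "connected_rel G = {(x, y). {x, y} \<in># medges G}\<^sup>*"

definition components :: "'a multigraph \<Rightarrow> 'a multigraph set" where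
  "components G =
    {induced_submultigraph G {w \<in> mverts G. (v, w) \<in> connected_rel G} | v. v \<in> mverts G}"

definition is_cycle_of_length :: "nat \<Rightarrow> 'a multigraph \<Rightarrow> bool" where
  "is_cycle_of_length k C \<longleftrightarrow>
    (\<exists>vs. length vs = k \<and> distinct vs \<and> mverts C = set vs \<and>
      medges C = mset (map (\<lambda>i. {vs ! i, vs ! (Suc i mod k)}) [0..<k]))"

text \<open>As usual, a graph has at least one vertex. This is required explicitly of a factor, since
  otherwise for a single partite set the null graph would be a partial factor.\<close>

definition partial_cycle_factor ::
    "nat \<Rightarrow> 'a multigraph \<Rightarrow> 'a set set \<Rightarrow> 'a multigraph \<Rightarrow> bool" where
  "partial_cycle_factor k G parts F \<longleftrightarrow>
    mverts F \<noteq> {} \<and>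
    (\<exists>V \<in> parts. spanning_submultigraph F (delete_vertices G V)) \<and>
    (\<forall>C \<in> components F. is_cycle_of_length k C)"

text \<open>Partitions of the edge multiset are multisets of factors, as parallel edges allow the same
  factor to occur repeatedly. A system contains at least one factor; otherwise every edgeless
  multigraph would have the empty system.\<close>

definition is_ARCS ::
    "nat \<Rightarrow> 'a multigraph \<Rightarrow> 'a set set \<Rightarrow> 'a multigraph multiset \<Rightarrow> bool" where
  "is_ARCS k G parts \<F> \<longleftrightarrow>
    \<F> \<noteq> {#} \<and>
    (\<forall>F \<in># \<F>. partial_cycle_factor k G parts F) \<and>
    (\<Sum>F \<in># \<F>. medges F) = medges G"

definition tensor_KK :: "nat \<Rightarrow> nat \<Rightarrow> nat \<Rightarrow> (nat \<times> nat) multigraph" where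
  "tensor_KK u g l = edge_multiple (tensor_product (complete_graph u) (complete_graph g)) l"

definition partite_sets :: "nat \<Rightarrow> nat \<Rightarrow> (nat \<times> nat) set set" where
  "partite_sets u g = {{i} \<times> gverts (complete_graph g) | i. i \<in> {1..u}}"

definition has_ARCS :: "nat \<Rightarrow> nat \<Rightarrow> nat \<Rightarrow> nat \<Rightarrow> bool" where
  "has_ARCS k u g l \<longleftrightarrow> (\<exists>\<F>. is_ARCS k (tensor_KK u g l) (partite_sets u g) \<F>)"

end

theory Submission
  imports Defs
begin

text \<open>Every factor omits exactly one partite set and is 2-regular on the remaining \<open>g (u - 1)\<close>
  vertices, which its cycles partition into classes of size \<open>k\<close>. For (iii), let \<open>r\<close> be the
  number of factors and \<open>n\<close> the number of factors covering a given vertex. Degrees give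
  \<open>2 n = l (u - 1) (g - 1)\<close>, and counting over one vertex in each partite set gives
  \<open>u n = (u - 1) r\<close>. Hence \<open>2 r = u l (g - 1)\<close>, so \<open>l (g - 1) = 2 (r - n)\<close>.\<close>

section \<open>Degrees and counting in multisets\<close>

definition mdegree :: "'a multigraph \<Rightarrow> 'a \<Rightarrow> nat" where
  "mdegree G v = size {# e \<in># medges G. v \<in> e #}"

lemma size_filter_sum_mset:
  "size (filter_mset P (\<Sum>x \<in># M. f x)) = (\<Sum>x \<in># M. size (filter_mset P (f x)))"
  by (induction M) auto

text \<open>Double counting of the pairs \<open>(i, x)\<close> with \<open>P i x\<close>, where
  \<open>i\<close> ranges over a set and \<open>x\<close> over a multiset.\<close>

lemma sum_size_filter_swap:
  assumes "finite A"
  shows "(\<Sum>i\<in>A. size {# x \<in># M. P i x #}) = (\<Sum>x \<in># M. card {i \<in> A. P i x})"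
proof (induction M)
  case empty
  then show ?case by simp
next
  case (add x M)
  have "(\<Sum>i\<in>A. size {# y \<in># add_mset x M. P i y #})
      = (\<Sum>i\<in>A. (if P i x then 1 else 0) + size {# y \<in># M. P i y #})"
    by (intro sum.cong) auto
  also have "\<dots> = card {i \<in> A. P i x} + (\<Sum>i\<in>A. size {# y \<in># M. P i y #})"
    using assms by (simp add: sum.distrib sum.If_cases Int_def)
  finally show ?case using add by simp
qed

lemma size_filter_repeat_mset:
  "size (filter_mset P (repeat_mset n M)) = n * size (filter_mset P M)"
  by (induction n) auto

section \<open>Cycles\<close>

lemma Suc_mod_eq_iff:
  assumes "i < k" "j < k"
  shows "Suc i mod k = j \<longleftrightarrow> i = (if j = 0 then k - 1 else j - 1)"
  using assms by (cases "Suc i = k") auto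

text \<open>The edge with index \<open>i\<close> joins the positions \<open>i\<close> and
  \<open>i + 1\<close> modulo \<open>k\<close>. So the vertex at position \<open>j\<close> lies on
  exactly the edges with index \<open>j\<close> and with the index cyclically preceding
  \<open>j\<close>. These indices differ because \<open>k \<ge> 2\<close>; for \<open>k = 2\<close>
  they carry equal edges, which the multiset counts twice.\<close>

lemma cycle_mdegree:
  assumes "is_cycle_of_length k C" "k \<ge> 2" "v \<in> mverts C"
  shows "mdegree C v = 2"
proof -
  obtain vs where vs: "length vs = k" "distinct vs" "mverts C = set vs"
    "medges C = mset (map (\<lambda>i. {vs ! i, vs ! (Suc i mod k)}) [0..<k])"
    using assms(1) unfolding is_cycle_of_length_def by blast
  obtain j where j: "j < k" "vs ! j = v"
    using assms(3) vs by (metis in_set_conv_nth)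
  \<comment> \<open>The cyclic predecessor of \<open>j\<close>, wrapping from \<open>0\<close> to
    \<open>k - 1\<close>.\<close>
  define p where "p = (if j = 0 then k - 1 else j - 1)"
  have v_in: "v \<in> {vs ! i, vs ! (Suc i mod k)} \<longleftrightarrow> i = j \<or> i = p" if "i < k" for i
  proof -
    \<comment> \<open>Both positions are valid, so distinctness of \<open>vs\<close> turns equality
      of vertices into equality of indices.\<close>
    have "Suc i mod k < k" using that by simp
    then have "v = vs ! i \<longleftrightarrow> i = j" "v = vs ! (Suc i mod k) \<longleftrightarrow> Suc i mod k = j"
      using vs(1,2) j that by (metis nth_eq_iff_index_eq)+
    then show ?thesis
      using Suc_mod_eq_iff[OF that j(1)] p_def by simp
  qed
  have "mdegree C v = length (filter (\<lambda>i. v \<in> {vs ! i, vs ! (Suc i mod k)}) [0..<k])"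
    unfolding mdegree_def vs(4) mset_filter[symmetric] size_mset filter_map length_map
    by (simp add: comp_def)
  also have "\<dots> = card (set (filter (\<lambda>i. v \<in> {vs ! i, vs ! (Suc i mod k)}) [0..<k]))"
    by (rule distinct_card[symmetric]) simp
  also have "set (filter (\<lambda>i. v \<in> {vs ! i, vs ! (Suc i mod k)}) [0..<k]) = {i. i < k \<and> (i = j \<or> i = p)}"
    unfolding set_filter by (intro Collect_cong conj_cong v_in) auto
  also have "\<dots> = {j, p}"
    using j(1) by (auto simp: p_def)
  also have "card {j, p} = 2"
    using assms(2) j(1) by (auto simp: p_def card_insert_if)
  finally show ?thesis .
qed

lemma cycle_card:
  assumes "is_cycle_of_length k C"
  shows "card (mverts C) = k"
  using assms distinct_card unfolding is_cycle_of_length_def by metis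

section \<open>Graphs whose components are cycles\<close>

lemma sym_connected_rel: "sym (connected_rel F)"
  unfolding connected_rel_def by (intro sym_rtrancl symI) (auto simp: insert_commute)

text \<open>Every edge at \<open>v\<close> stays inside the component of \<open>v\<close>, so
  \<open>v\<close> has the same degree in \<open>F\<close> as in the cycle that is its
  component.\<close>

lemma cycle_factor_mdegree:
  assumes cyc: "\<forall>C \<in> components F. is_cycle_of_length k C" and "k \<ge> 2"
    and edges: "\<And>e. e \<in># medges F \<Longrightarrow> e \<subseteq> mverts F \<and> (\<exists>x y. e = {x, y})"
    and v: "v \<in> mverts F"
  shows "mdegree F v = 2"
proof -
  define W where "W = {w \<in> mverts F. (v, w) \<in> connected_rel F}"
  let ?C = "induced_submultigraph F W"
  have "?C \<in> components F"
    unfolding components_def W_def using v by blast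
  moreover have "v \<in> W"
    using v by (simp add: W_def connected_rel_def)
  ultimately have "mdegree ?C v = 2"
    using cyc \<open>k \<ge> 2\<close> by (intro cycle_mdegree) (auto simp: induced_submultigraph_def)
  moreover have "e \<subseteq> W" if e: "e \<in># medges F" "v \<in> e" for e
  proof
    fix w assume w: "w \<in> e"
    have "w = v \<or> e = {v, w}"
      using edges[OF e(1)] e(2) w by auto
    then have "(v, w) \<in> connected_rel F"
      using e(1) unfolding connected_rel_def by auto
    then show "w \<in> W"
      using edges[OF e(1)] w by (auto simp: W_def)
  qed
  then have "mdegree ?C v = mdegree F v"
    unfolding mdegree_def induced_submultigraph_def multigraph.simps filter_filter_mset
    by (intro arg_cong[where f = size] filter_mset_cong) auto
  ultimately show ?thesis by simp
qed

text \<open>Connectedness is an equivalence relation, and its classes on \<open>mverts F\<close> are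
  the vertex sets of the components, each of size \<open>k\<close>.\<close>

lemma cycle_factor_dvd_card:
  assumes cyc: "\<forall>C \<in> components F. is_cycle_of_length k C" and "finite (mverts F)"
  shows "k dvd card (mverts F)"
proof -
  let ?cl = "\<lambda>v. {w \<in> mverts F. (v, w) \<in> connected_rel F}"
  have sym: "(w, v) \<in> connected_rel F" if "(v, w) \<in> connected_rel F" for v w
    using sym_connected_rel that by (meson symD)
  have trans: "(v, z) \<in> connected_rel F"
    if "(v, w) \<in> connected_rel F" "(w, z) \<in> connected_rel F" for v w z
    using that unfolding connected_rel_def by simp
  have Un: "\<Union> (?cl ` mverts F) = mverts F"
    by (auto simp: connected_rel_def)
  have "k dvd card (\<Union> (?cl ` mverts F))"
  proof (rule dvd_partition)
    show "finite (\<Union> (?cl ` mverts F))"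
      using assms(2) Un by simp
    show "\<forall>c\<in>?cl ` mverts F. k dvd card c"
    proof
      fix c assume "c \<in> ?cl ` mverts F"
      then have "induced_submultigraph F c \<in> components F"
        unfolding components_def by blast
      then have "card (mverts (induced_submultigraph F c)) = k"
        using cyc cycle_card by blast
      then show "k dvd card c"
        by (simp add: induced_submultigraph_def)
    qed
    show "\<forall>c1\<in>?cl ` mverts F. \<forall>c2\<in>?cl ` mverts F. c1 \<noteq> c2 \<longrightarrow> c1 \<inter> c2 = {}"
      using sym trans by blast
  qed
  then show ?thesis by (simp only: Un)
qed

section \<open>The multigraph (K_u x K_g)(l)\<close>

abbreviation KK_edges :: "nat \<Rightarrow> nat \<Rightarrow> (nat \<times> nat) set set" where
  "KK_edges u g \<equiv> gedges (tensor_product (complete_graph u) (complete_graph g))"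

lemma KK_edges_iff:
  "e \<in> KK_edges u g \<longleftrightarrow> (\<exists>i h j h'. e = {(i, h), (j, h')} \<and> i \<in> {1..u} \<and> j \<in> {1..u} \<and> i \<noteq> j
    \<and> h \<in> {1..g} \<and> h' \<in> {1..g} \<and> h \<noteq> h')"
proof -
  have "{a, b} \<in> gedges (complete_graph n) \<longleftrightarrow> a \<in> {1..n} \<and> b \<in> {1..n} \<and> a \<noteq> b" for a b n
    by (auto simp: complete_graph_def doubleton_eq_iff)
  then show ?thesis
    unfolding tensor_product_def by simp
qed

lemma finite_KK_edges: "finite (KK_edges u g)"
proof (rule finite_subset)
  show "KK_edges u g \<subseteq> Pow ({1..u} \<times> {1..g})"
    by (auto simp: KK_edges_iff)
qed simp

lemma mverts_tensor_KK: "mverts (tensor_KK u g l) = {1..u} \<times> {1..g}"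
  by (simp add: tensor_KK_def edge_multiple_def tensor_product_def complete_graph_def)

lemma medges_tensor_KK: "medges (tensor_KK u g l) = repeat_mset l (mset_set (KK_edges u g))"
  by (simp add: tensor_KK_def edge_multiple_def)

lemma in_medges_tensor_KK: "e \<in># medges (tensor_KK u g l) \<Longrightarrow> e \<in> KK_edges u g"
  unfolding medges_tensor_KK by (induction l) (auto simp: finite_KK_edges)

text \<open>The neighbours of \<open>(i, h)\<close> are the vertices that differ from it in both
  coordinates. Sending a neighbour to its edge with \<open>(i, h)\<close> is a bijection onto the
  simple edges at \<open>(i, h)\<close>, each of which occurs \<open>l\<close> times.\<close>

lemma mdegree_tensor_KK:
  assumes "i \<in> {1..u}" "h \<in> {1..g}"
  shows "mdegree (tensor_KK u g l) (i, h) = l * ((u - 1) * (g - 1))"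
proof -
  let ?f = "\<lambda>w. {(i, h), w}"
  have "{e \<in> KK_edges u g. (i, h) \<in> e} = ?f ` (({1..u} - {i}) \<times> ({1..g} - {h}))"
    (is "?L = ?R")
  proof
    show "?L \<subseteq> ?R"
    proof
      fix e assume "e \<in> ?L"
      then obtain a b c d where e: "e = {(a, b), (c, d)}" "a \<in> {1..u}" "c \<in> {1..u}" "a \<noteq> c"
        "b \<in> {1..g}" "d \<in> {1..g}" "b \<noteq> d" and "(i, h) \<in> e"
        by (auto simp: KK_edges_iff)
      then consider "i = a" "h = b" | "i = c" "h = d" by auto
      then show "e \<in> ?R"
      proof cases
        case 1
        then show ?thesis using e by (intro image_eqI[of _ _ "(c, d)"]) auto
      next
        case 2
        then show ?thesis using e by (intro image_eqI[of _ _ "(a, b)"]) auto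
      qed
    qed
    show "?R \<subseteq> ?L"
    proof
      fix e assume "e \<in> ?R"
      then obtain j h' where "e = {(i, h), (j, h')}" "j \<in> {1..u} - {i}" "h' \<in> {1..g} - {h}"
        by blast
      then show "e \<in> ?L"
        using assms unfolding KK_edges_iff by blast
    qed
  qed
  moreover have "inj_on ?f (({1..u} - {i}) \<times> ({1..g} - {h}))"
    by (auto simp: inj_on_def doubleton_eq_iff)
  ultimately have "card {e \<in> KK_edges u g. (i, h) \<in> e} = (u - 1) * (g - 1)"
    using assms by (simp add: card_image card_cartesian_product)
  then show ?thesis
    by (simp add: mdegree_def medges_tensor_KK size_filter_repeat_mset filter_mset_mset_set
        finite_KK_edges)
qed

section \<open>A single partial factor\<close>

locale KK_partial_factor =
  fixes k u g l :: nat and F :: "(nat \<times> nat) multigraph"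
  assumes k_ge_2: "k \<ge> 2"
    and factor: "partial_cycle_factor k (tensor_KK u g l) (partite_sets u g) F"
begin

lemma obtain_omitted_part:
  obtains i where "i \<in> {1..u}" "mverts F = ({1..u} - {i}) \<times> {1..g}"
proof -
  obtain i where "i \<in> {1..u}"
    "mverts F = mverts (delete_vertices (tensor_KK u g l) ({i} \<times> {1..g}))"
    using factor
    unfolding partial_cycle_factor_def spanning_submultigraph_def partite_sets_def
      complete_graph_def
    by auto
  then show ?thesis
    by (intro that[of i]) (auto simp: delete_vertices_def mverts_tensor_KK)
qed

lemma edge:
  assumes "e \<in># medges F"
  shows "e \<subseteq> mverts F" "e \<in> KK_edges u g"
proof -
  obtain V where "submultigraph F (delete_vertices (tensor_KK u g l) V)"
    using factor unfolding partial_cycle_factor_def spanning_submultigraph_def by blast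
  then have "e \<subseteq> mverts F" "e \<in># medges (tensor_KK u g l)"
    using assms unfolding submultigraph_def delete_vertices_def by (auto dest: mset_subset_eqD)
  then show "e \<subseteq> mverts F" "e \<in> KK_edges u g"
    using in_medges_tensor_KK by blast+
qed

text \<open>Covered vertices inherit degree 2 from their cycle. The omitted vertices have degree 0,
  since every edge of \<open>F\<close> lies within \<open>mverts F\<close>.\<close>

lemma mdegree: "mdegree F v = (if v \<in> mverts F then 2 else 0)"
proof (cases "v \<in> mverts F")
  case True
  have "mdegree F v = 2"
  proof (rule cycle_factor_mdegree)
    show "\<forall>C \<in> components F. is_cycle_of_length k C"
      using factor by (simp add: partial_cycle_factor_def)
    show "e \<subseteq> mverts F \<and> (\<exists>x y. e = {x, y})" if "e \<in># medges F" for e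
      using edge[OF that] unfolding KK_edges_iff by blast
  qed (use True k_ge_2 in auto)
  then show ?thesis using True by simp
next
  case False
  then have "{# e \<in># medges F. v \<in> e #} = {#}"
    using edge(1) by auto
  then show ?thesis using False by (simp add: mdegree_def)
qed

lemma dvd: "k dvd g * (u - 1)"
proof -
  obtain i where i: "i \<in> {1..u}" "mverts F = ({1..u} - {i}) \<times> {1..g}"
    by (rule obtain_omitted_part)
  have "k dvd card (mverts F)"
    using factor i by (intro cycle_factor_dvd_card) (auto simp: partial_cycle_factor_def)
  then show ?thesis
    using i by (simp add: card_cartesian_product mult.commute)
qed

text \<open>A factor has a vertex, whose degree 2 forces an edge. The ends of this edge lie in two
  different parts, both different from the omitted one, which makes three parts. Their second
  coordinates also differ.\<close>

lemma u_ge_3_g_ge_2: "u \<ge> 3 \<and> g \<ge> 2"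
proof -
  obtain i where i: "i \<in> {1..u}" "mverts F = ({1..u} - {i}) \<times> {1..g}"
    by (rule obtain_omitted_part)
  obtain v where "v \<in> mverts F"
    using factor unfolding partial_cycle_factor_def by blast
  then have "mdegree F v = 2" by (simp add: mdegree)
  then obtain e where e: "e \<in># medges F"
    unfolding mdegree_def by (metis filter_mset_eq_mempty_iff size_empty zero_neq_numeral)
  obtain a b c d where "a \<in> {1..u} - {i}" "c \<in> {1..u} - {i}" "a \<noteq> c"
    "b \<in> {1..g}" "d \<in> {1..g}" "b \<noteq> d"
    using edge[OF e] i unfolding KK_edges_iff by auto
  then show ?thesis using i(1) by auto
qed

text \<open>The vertices \<open>(i, h)\<close> with fixed \<open>h\<close> represent the parts, and
  a factor misses exactly the representative of its omitted part.\<close>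

lemma card_covered_parts:
  assumes "h \<in> {1..g}"
  shows "card {i \<in> {1..u}. (i, h) \<in> mverts F} = u - 1"
proof -
  obtain j where j: "j \<in> {1..u}" "mverts F = ({1..u} - {j}) \<times> {1..g}"
    by (rule obtain_omitted_part)
  have "{i \<in> {1..u}. (i, h) \<in> mverts F} = {1..u} - {j}"
    unfolding j(2) using assms by blast
  then show ?thesis using j(1) by simp
qed

end

section \<open>Parity from counting over the whole system\<close>

lemma ARCS_even:
  assumes arcs: "is_ARCS k (tensor_KK u g l) (partite_sets u g) \<F>"
    and "k \<ge> 2" "u \<ge> 2" "g \<ge> 1"
  shows "even (l * (g - 1))"
proof -
  have fac: "KK_partial_factor k u g l F" if "F \<in># \<F>" for F
    using arcs that \<open>k \<ge> 2\<close> by (simp add: KK_partial_factor_def is_ARCS_def)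
  \<comment> \<open>The vertex \<open>(i, 1)\<close> represents part \<open>i\<close>; it exists
    because \<open>g \<ge> 1\<close>.\<close>
  define n where "n i = size {# F \<in># \<F>. (i, 1) \<in> mverts F #}" for i
  have deg: "2 * n i = l * ((u - 1) * (g - 1))" if "i \<in> {1..u}" for i
  proof -
    have "l * ((u - 1) * (g - 1)) = mdegree (tensor_KK u g l) (i, 1)"
      using mdegree_tensor_KK[OF that] \<open>g \<ge> 1\<close> by simp
    \<comment> \<open>The factors partition the edge multiset, so their degrees at a vertex add
      up.\<close>
    also have "\<dots> = (\<Sum>F \<in># \<F>. mdegree F (i, 1))"
      using arcs unfolding mdegree_def is_ARCS_def by (metis size_filter_sum_mset)
    also have "\<dots> = (\<Sum>F \<in># \<F>. if (i, 1) \<in> mverts F then 2 else 0)"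
      using KK_partial_factor.mdegree[OF fac]
      by (intro arg_cong[where f = sum_mset] image_mset_cong) simp
    also have "\<dots> = 2 * n i"
      unfolding n_def by (induction \<F>) auto
    finally show ?thesis by simp
  qed
  have "(\<Sum>i\<in>{1..u}. n i) = (\<Sum>F \<in># \<F>. card {i \<in> {1..u}. (i, 1) \<in> mverts F})"
    unfolding n_def by (rule sum_size_filter_swap) simp
  also have "\<dots> = (\<Sum>F \<in># \<F>. u - 1)"
    using KK_partial_factor.card_covered_parts[OF fac] \<open>g \<ge> 1\<close>
    by (intro arg_cong[where f = sum_mset] image_mset_cong) simp
  finally have "2 * (\<Sum>i\<in>{1..u}. n i) = 2 * ((u - 1) * size \<F>)"
    by simp
  moreover have "2 * (\<Sum>i\<in>{1..u}. n i) = u * (l * ((u - 1) * (g - 1)))"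
    using deg by (simp add: sum_distrib_left)
  ultimately have "(u - 1) * (u * (l * (g - 1))) = (u - 1) * (2 * size \<F>)"
    by (simp only: ac_simps)
  \<comment> \<open>The factor \<open>u - 1\<close> cancels, being nonzero for
    \<open>u \<ge> 2\<close>.\<close>
  then have "u * (l * (g - 1)) = 2 * size \<F>"
    using \<open>u \<ge> 2\<close> by simp
  \<comment> \<open>Splitting \<open>u\<close> as \<open>1 + (u - 1)\<close> isolates one copy of
    \<open>l * (g - 1)\<close>; the rest is \<open>2 * n 1\<close> by the degree equation at part 1.
    This keeps the final identity free of subtraction between the two counts.\<close>
  moreover have "u * (l * (g - 1)) = l * (g - 1) + 2 * n 1"
  proof -
    have "u * (l * (g - 1)) = l * (g - 1) + (u - 1) * (l * (g - 1))"
      using \<open>u \<ge> 2\<close> by (cases u) simp_all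
    then show ?thesis
      using deg[of 1] \<open>u \<ge> 2\<close> by (simp add: mult.left_commute)
  qed
  ultimately have "l * (g - 1) + 2 * n 1 = 2 * size \<F>" by simp
  then show ?thesis by presburger
qed

theorem theorem1p1:
  fixes k u g l :: nat
  assumes "k \<ge> 4" and "even k"
    and "u > 0" and "g > 0" and "l > 0"
    and "has_ARCS k u g l"
  shows "(u \<ge> 3 \<and> g \<ge> 2) \<and> [g * (u - 1) = 0] (mod k) \<and> [l * (g - 1) = 0] (mod 2)"
proof -
  obtain \<F> where arcs: "is_ARCS k (tensor_KK u g l) (partite_sets u g) \<F>"
    using assms(6) unfolding has_ARCS_def by blast
  \<comment> \<open>A system is nonempty, and any one of its factors yields (i) and (ii).\<close>
  then obtain F where "F \<in># \<F>"
    unfolding is_ARCS_def by blast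
  then interpret KK_partial_factor k u g l F
    using arcs assms(1) by unfold_locales (auto simp: is_ARCS_def)
  have "u \<ge> 3 \<and> g \<ge> 2" by (rule u_ge_3_g_ge_2)
  \<comment> \<open>Part (i) supplies the bounds on \<open>u\<close> and \<open>g\<close> that the
    parity argument assumes.\<close>
  moreover have "even (l * (g - 1))"
    using ARCS_even[OF arcs] assms(1) calculation by simp
  ultimately show ?thesis
    using dvd by (simp add: cong_0_iff)
qed

end
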